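(* Let $\langle X \mid R\rangle$ be a group presentation, where $R$ is a set of non-empty cyclically reduced words with $R^{-1}\subset R$, and let $D_k$ ($k\geqslant 1$) and $D=\bigcup_{k\geqslant 1}D_k$ be the sets of words defined in the context. Let $w$ be a relator of $\langle X\mid R\rangle$. Then $w$ belongs to $D$. Moreover $\mathrm{Area}(w)=\min\{k : w\in D_k\}$.
   Context: Words are elements of the free monoid on $X\cup X^{-1}$ (letters); $|w|$ is the length of $w$, $\rho(w)$ is the freely reduced form of $w$, and the free group $\mathcal F(X)$ is identified with the set of reduced words. A relator is a reduced word belonging to the normal closure $\mathcal N$ of $R$ in $\mathcal F(X)$. $\mathrm{Area}(w)$ of a relator $w$ is the least $k$ such that $w=\rho(a_1r_1a_1^{-1}\cdots a_kr_ka_k^{-1})$ with $r_i\in R$, $a_i\in\mathcal F(X)$. A reduced word is cyclically reduced if its last letter is not the inverse of its first. If $w=w_1w_2$, the word $w_2w_1$ is a cyclic conjugate of $w$. For a word $u$ there are unique reduced $t$ and cyclically reduced $w$ with $\rho(u)=twt^{-1}$ (equality of words); $w$ is the cyclically reduced form of $u$. The cyclically reduced product $\pi(u,v)$ is the cyclically reduced form of $uv$. If $w=w_1w_2$ and $u$ are words ($w_1$, $w_2$ possibly empty), $w_1uw_2$ is an insertion of $u$ into $w$. $C_1$ is the set of cyclic conjugates of elements of $R$. For $k>1$, $C_k$ is the set of cyclic conjugates of the words $\pi(u,v)$ where: (1) $u\in C_{k-1}$ and $v\in C_1$, or $u\in C_1$ and $v\in C_{k-1}$; (2) $u\neq v^{-1}$;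 (3) either $u^{-1}$ is a prefix of $v$, or $v^{-1}$ is a suffix of $u$, or the last letter of $u$ is the inverse of the first letter of $v$ but the first letter of $u$ is not the inverse of the last letter of $v$. $D_1$ is the set of reduced words of the form $uwu^{-1}$ with $w\in C_1$ ($u$ a possibly empty word). For $k>1$, $D_k$ is the set of reduced words which are either of the form $uwu^{-1}$ with $w\in C_k$ ($u$ possibly empty), or insertions of a word of $D_m$ into a word of $D_n$ for some $m,n\geqslant1$ with $m+n=k$.
   Formalization: The relator w is assumed to be non-empty: the empty word is a relator of area 0 but belongs to no D_k, so the claim fails for it as stated. *)

theory Defs
  imports "HOL-Algebra.Coset" "HOL-Library.Sublist"
begin

text \<open>
  The letter \<open>(x, True)\<close> is the generator \<open>x\<close> and \<open>(x, False)\<close> is its formal inverse.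
\<close>

type_synonym 'x letter = "'x \<times> bool"
type_synonym 'x word = "'x letter list"

definition letter_inv :: "'x letter \<Rightarrow> 'x letter" where
  "letter_inv a = (fst a, \<not> snd a)"

definition word_inv :: "'x word \<Rightarrow> 'x word" where
  "word_inv w = rev (map letter_inv w)"

definition words :: "'x set \<Rightarrow> 'x word set" where
  "words X = lists (X \<times> UNIV)"

definition reduced :: "'x word \<Rightarrow> bool" where
  "reduced w \<longleftrightarrow> successively (\<lambda>a b. b \<noteq> letter_inv a) w"

fun red_cons :: "'x letter \<Rightarrow> 'x word \<Rightarrow> 'x word" where
  "red_cons a [] = [a]"
| "red_cons a (b # w) = (if b = letter_inv a then w else a # b # w)"

text \<open>The freely reduced form, computed by cancelling from right to left.\<close>

definition rho :: "'x word \<Rightarrow> 'x word" where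
  "rho w = foldr red_cons w []"

definition free_group :: "'x set \<Rightarrow> 'x word monoid" where
  "free_group X = \<lparr>carrier = {w \<in> words X. reduced w}, mult = (\<lambda>u v. rho (u @ v)), one = []\<rparr>"

definition normal_closure :: "('a, 'b) monoid_scheme \<Rightarrow> 'a set \<Rightarrow> 'a set" where
  "normal_closure G S = \<Inter> {N. N \<lhd> G \<and> S \<subseteq> N}"

definition relators :: "'x set \<Rightarrow> 'x word set \<Rightarrow> 'x word set" where
  "relators X R = normal_closure (free_group X) R"

definition Area :: "'x set \<Rightarrow> 'x word set \<Rightarrow> 'x word \<Rightarrow> nat" where
  "Area X R w = (LEAST k. \<exists>ps. length ps = k \<and> set ps \<subseteq> carrier (free_group X) \<times> R \<and>
     w = rho (concat (map (\<lambda>(a, r). a @ r @ word_inv a) ps)))"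

text \<open>The empty word counts as cyclically reduced.\<close>

definition cyclically_reduced :: "'x word \<Rightarrow> bool" where
  "cyclically_reduced w \<longleftrightarrow> reduced w \<and> (w \<noteq> [] \<longrightarrow> last w \<noteq> letter_inv (hd w))"

definition cyclic_conjugates :: "'x word \<Rightarrow> 'x word set" where
  "cyclic_conjugates w = {w2 @ w1 | w1 w2. w = w1 @ w2}"

definition cyc_red_form :: "'x word \<Rightarrow> 'x word" where
  "cyc_red_form u = (THE w. cyclically_reduced w \<and>
     (\<exists>t. reduced t \<and> rho u = t @ w @ word_inv t))"

definition cyc_red_prod :: "'x word \<Rightarrow> 'x word \<Rightarrow> 'x word" where
  "cyc_red_prod u v = cyc_red_form (u @ v)"

definition insertions :: "'x word \<Rightarrow> 'x word \<Rightarrow> 'x word set" where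
  "insertions u w = {w1 @ u @ w2 | w1 w2. w = w1 @ w2}"

text \<open>The index set is \<open>k \<ge> 1\<close>; the value at \<open>0\<close> is a dummy.\<close>

fun C_set :: "'x word set \<Rightarrow> nat \<Rightarrow> 'x word set" where
  "C_set R 0 = {}"
| "C_set R (Suc 0) = (\<Union>r\<in>R. cyclic_conjugates r)"
| "C_set R (Suc (Suc k)) = \<Union> {cyclic_conjugates (cyc_red_prod u v) | u v.
     (u \<in> C_set R (Suc k) \<and> v \<in> C_set R (Suc 0) \<or>
      u \<in> C_set R (Suc 0) \<and> v \<in> C_set R (Suc k)) \<and>
     u \<noteq> word_inv v \<and>
     (prefix (word_inv u) v \<or> suffix (word_inv v) u \<or>
      u \<noteq> [] \<and> v \<noteq> [] \<and> last u = letter_inv (hd v) \<and> hd u \<noteq> letter_inv (last v))}"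

text \<open>
  The recursion defining the sets \<open>D\<^sub>k\<close>, written as a predicate on index and word;
  the second rule only produces indices \<open>m + n \<ge> 2\<close>.
\<close>

inductive in_D :: "'x set \<Rightarrow> 'x word set \<Rightarrow> nat \<Rightarrow> 'x word \<Rightarrow> bool"
  for X :: "'x set" and R :: "'x word set" where
  conj: "\<lbrakk>k \<ge> 1; w \<in> C_set R k; u \<in> words X; reduced (u @ w @ word_inv u)\<rbrakk>
    \<Longrightarrow> in_D X R k (u @ w @ word_inv u)"
| insert: "\<lbrakk>m \<ge> 1; n \<ge> 1; in_D X R m u; in_D X R n w; v \<in> insertions u w; reduced v\<rbrakk>
    \<Longrightarrow> in_D X R (m + n) v"

definition D_set :: "'x set \<Rightarrow> 'x word set \<Rightarrow> nat \<Rightarrow> 'x word set" where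
  "D_set X R k = {w. in_D X R k w}"

definition D_union :: "'x set \<Rightarrow> 'x word set \<Rightarrow> 'x word set" where
  "D_union X R = (\<Union>k\<in>{1..}. D_set X R k)"


subsection \<open>Well-definedness\<close>

lemma letter_inv_inv [simp]: "letter_inv (letter_inv a) = a"
  by (simp add: letter_inv_def)

lemma letter_inv_neq [simp]: "letter_inv a \<noteq> a" "a \<noteq> letter_inv a"
  by (cases a; simp add: letter_inv_def)+

lemma letter_inv_eq [simp]: "letter_inv a = letter_inv b \<longleftrightarrow> a = b"
  by (metis letter_inv_inv)

lemma word_inv_simps [simp]:
  "word_inv [] = []" "word_inv (a # w) = word_inv w @ [letter_inv a]"
  "word_inv (u @ v) = word_inv v @ word_inv u"
  by (simp_all add: word_inv_def)

lemma word_inv_inv [simp]: "word_inv (word_inv w) = w"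
  by (induction w) auto

lemma word_inv_Nil_iff [simp]: "word_inv w = [] \<longleftrightarrow> w = []"
  by (simp add: word_inv_def)

lemma length_word_inv [simp]: "length (word_inv w) = length w"
  by (simp add: word_inv_def)

lemma reduced_Nil [simp]: "reduced []"
  by (simp add: reduced_def)

lemma reduced_Cons: "reduced (a # w) \<longleftrightarrow> reduced w \<and> (w = [] \<or> hd w \<noteq> letter_inv a)"
  by (auto simp: reduced_def successively_Cons)

lemma reduced_append:
  "reduced (u @ v) \<longleftrightarrow> reduced u \<and> reduced v \<and> (u = [] \<or> v = [] \<or> hd v \<noteq> letter_inv (last u))"
  by (auto simp: reduced_def successively_append_iff)

lemma reduced_word_inv [simp]: "reduced (word_inv w) \<longleftrightarrow> reduced w"
proof -
  have *: "reduced w \<Longrightarrow> reduced (word_inv w)" for w :: "'a word"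
  proof (induction w)
    case (Cons a w)
    then show ?case
      by (cases w) (auto simp: reduced_Cons reduced_append)
  qed simp
  show ?thesis using *[of w] *[of "word_inv w"] by auto
qed

lemma words_simps [simp]:
  "[] \<in> words X" "a # w \<in> words X \<longleftrightarrow> fst a \<in> X \<and> w \<in> words X"
  "u @ v \<in> words X \<longleftrightarrow> u \<in> words X \<and> v \<in> words X"
  by (auto simp: words_def mem_Times_iff)

lemma word_inv_words [simp]: "word_inv w \<in> words X \<longleftrightarrow> w \<in> words X"
  by (induction w) (auto simp: letter_inv_def)

lemma reduced_red_cons: "reduced w \<Longrightarrow> reduced (red_cons a w)"
  by (cases w) (auto simp: reduced_Cons)

lemma red_cons_cancel: "reduced w \<Longrightarrow> red_cons (letter_inv a) (red_cons a w) = w"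
  by (cases w rule: remdups_adj.cases) (auto simp: reduced_Cons)

lemma red_cons_reduced: "reduced (a # w) \<Longrightarrow> red_cons a w = a # w"
  by (cases w) (auto simp: reduced_Cons)

lemma rho_simps [simp]: "rho [] = []" "rho (a # w) = red_cons a (rho w)"
  by (simp_all add: rho_def)

lemma rho_append: "rho (u @ v) = foldr red_cons u (rho v)"
  by (simp add: rho_def)

lemma reduced_foldr: "reduced v \<Longrightarrow> reduced (foldr red_cons u v)"
  by (induction u) (auto intro: reduced_red_cons)

lemma reduced_rho [simp]: "reduced (rho w)"
  by (simp add: rho_def reduced_foldr)

lemma rho_reduced: "reduced w \<Longrightarrow> rho w = w"
  by (induction w) (auto simp: red_cons_reduced reduced_Cons)

lemma foldr_rho: "reduced x \<Longrightarrow> foldr red_cons (rho u) x = foldr red_cons u x"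
proof (induction u)
  case (Cons a u)
  show ?case
  proof (cases "rho u")
    case Nil
    then show ?thesis using Cons by simp
  next
    case (Cons b v)
    have "red_cons a (foldr red_cons (b # v) x) = foldr red_cons v x" if "b = letter_inv a"
      using red_cons_cancel[of "foldr red_cons v x" "letter_inv a"] that
      by (simp add: reduced_foldr Cons.prems)
    then show ?thesis using Cons Cons.IH Cons.prems by auto
  qed
qed simp

lemma rho_rho_append1 [simp]: "rho (rho u @ v) = rho (u @ v)"
  by (simp add: rho_append foldr_rho)

lemma rho_rho_append2 [simp]: "rho (u @ rho v) = rho (u @ v)"
  by (simp add: rho_append rho_reduced)

lemma rho_cancel: "rho (u @ a # letter_inv a # v) = rho (u @ v)"
  using red_cons_cancel[of "rho v" "letter_inv a"] by (simp add: rho_append)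

lemma rho_word_inv_left: "rho (word_inv w @ w) = []"
proof (induction w)
  case (Cons a w)
  then show ?case
    using rho_cancel[of "word_inv w" "letter_inv a" w] by simp
qed simp

lemma red_cons_words: "fst a \<in> X \<Longrightarrow> w \<in> words X \<Longrightarrow> red_cons a w \<in> words X"
  by (cases w) auto

lemma rho_words: "w \<in> words X \<Longrightarrow> rho w \<in> words X"
  by (induction w) (auto intro: red_cons_words)

lemma group_free_group: "group (free_group X)"
proof (rule groupI)
  fix x y z
  assume "x \<in> carrier (free_group X)" "y \<in> carrier (free_group X)" "z \<in> carrier (free_group X)"
  show "x \<otimes>\<^bsub>free_group X\<^esub> y \<otimes>\<^bsub>free_group X\<^esub> z = x \<otimes>\<^bsub>free_group X\<^esub> (y \<otimes>\<^bsub>free_group X\<^esub> z)"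
    by (simp add: free_group_def)
next
  fix x assume x: "x \<in> carrier (free_group X)"
  show "\<exists>y\<in>carrier (free_group X). y \<otimes>\<^bsub>free_group X\<^esub> x = \<one>\<^bsub>free_group X\<^esub>"
    using x rho_word_inv_left[of x] by (intro bexI[of _ "word_inv x"]) (auto simp: free_group_def)
qed (auto simp: free_group_def rho_reduced rho_words)

lemma reduced_conj_unique:
  assumes "t @ w @ word_inv t = t' @ w' @ word_inv t'" "reduced (t @ w @ word_inv t)"
    and "cyclically_reduced w" "cyclically_reduced w'"
  shows "t = t' \<and> w = w'"
  using assms
proof (induction t arbitrary: t')
  case Nil
  show ?case
  proof (cases t')
    case (Cons a s)
    then show ?thesis using Nil by (auto simp: cyclically_reduced_def)
  qed (use Nil in auto)
next
  case (Cons a t)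
  show ?case
  proof (cases t')
    case Nil
    then have "w' = a # t @ w @ word_inv t @ [letter_inv a]"
      using Cons.prems(1) by simp
    then show ?thesis using Cons.prems(4) by (auto simp: cyclically_reduced_def)
  next
    case (Cons b s)
    have "a = b" using Cons.prems(1) Cons by simp
    moreover have "t @ w @ word_inv t = s @ w' @ word_inv s"
      using Cons.prems(1) Cons by simp
    moreover have "reduced (t @ w @ word_inv t)"
      using Cons.prems(2) reduced_append[of "t @ w @ word_inv t" "[letter_inv a]"]
      by (auto simp: reduced_Cons)
    ultimately show ?thesis using Cons.IH[of s] Cons.prems(3,4) Cons by auto
  qed
qed

lemma reduced_conj_exists:
  assumes "reduced u"
  shows "\<exists>t w. reduced t \<and> cyclically_reduced w \<and> u = t @ w @ word_inv t"
  using assms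
proof (induction u rule: length_induct)
  case (1 u)
  show ?case
  proof (cases "cyclically_reduced u")
    case True
    then show ?thesis by (intro exI[of _ "[]"] exI[of _ u]) auto
  next
    case False
    then have u: "u \<noteq> []" "last u = letter_inv (hd u)"
      using 1 by (auto simp: cyclically_reduced_def)
    then obtain a v where v: "u = a # v" by (cases u) auto
    then have "v \<noteq> []" using u by auto
    then obtain s where s: "u = a # s @ [letter_inv a]"
      using u v by (metis append_butlast_last_id last.simps list.sel(1))
    then have "reduced s" using 1 by (auto simp: reduced_Cons reduced_append)
    then obtain t w where tw: "reduced t" "cyclically_reduced w" "s = t @ w @ word_inv t"
      using 1 s by (metis length_Cons length_append_singleton less_Suc_eq)
    have "u = (a # t) @ w @ word_inv (a # t)" using s tw by simp
    moreover from this have "reduced (a # t)"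
      using 1 by (metis reduced_append)
    ultimately show ?thesis using tw by blast
  qed
qed

lemma cyc_red_form_ex1:
  "\<exists>!w. cyclically_reduced w \<and> (\<exists>t. reduced t \<and> rho u = t @ w @ word_inv t)"
proof -
  obtain t w where tw: "reduced t" "cyclically_reduced w" "rho u = t @ w @ word_inv t"
    using reduced_conj_exists[OF reduced_rho[of u]] by blast
  show ?thesis
  proof (rule ex1I[of _ w])
    fix w' assume "cyclically_reduced w' \<and> (\<exists>t. reduced t \<and> rho u = t @ w' @ word_inv t)"
    then obtain t' where "cyclically_reduced w'" "rho u = t' @ w' @ word_inv t'" by blast
    then show "w' = w"
      using reduced_conj_unique[of t w t' w'] tw reduced_rho[of u] by simp
  qed (use tw in blast)
qed

lemma cyc_red_form:
  "cyclically_reduced (cyc_red_form u)"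
  "\<exists>t. reduced t \<and> rho u = t @ cyc_red_form u @ word_inv t"
  using theI'[OF cyc_red_form_ex1[of u]] unfolding cyc_red_form_def by auto

lemma cyclically_reduced_conjugate:
  assumes "cyclically_reduced w" "v \<in> cyclic_conjugates w"
  shows "cyclically_reduced v"
proof -
  obtain w1 w2 where w: "w = w1 @ w2" "v = w2 @ w1"
    using assms(2) by (auto simp: cyclic_conjugates_def)
  show ?thesis
  proof (cases "w1 = [] \<or> w2 = []")
    case True
    then show ?thesis using assms(1) w by auto
  next
    case False
    then have "reduced w1" "reduced w2" "hd w2 \<noteq> letter_inv (last w1)" "last w2 \<noteq> letter_inv (hd w1)"
      using assms(1) w by (simp_all add: cyclically_reduced_def reduced_append)
    moreover from this have "hd w1 \<noteq> letter_inv (last w2)" "last w1 \<noteq> letter_inv (hd w2)"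
      by (metis letter_inv_inv)+
    ultimately show ?thesis
      using False w by (simp add: cyclically_reduced_def reduced_append)
  qed
qed

lemma rho_append_eq_Nil:
  assumes "reduced u" "reduced v" "rho (u @ v) = []"
  shows "u = word_inv v"
proof -
  have "rho (u @ v @ word_inv v) = rho (rho (u @ v) @ word_inv v)" by simp
  also have "\<dots> = word_inv v" using assms by (simp add: rho_reduced)
  finally have "rho (u @ v @ word_inv v) = word_inv v" .
  moreover have "rho (u @ v @ word_inv v) = rho (u @ rho (v @ word_inv v))" by simp
  moreover have "rho (v @ word_inv v) = []" using rho_word_inv_left[of "word_inv v"] by simp
  ultimately show ?thesis using assms by (simp only: append_Nil2 rho_reduced)
qed

lemma C_set_nonempty:
  assumes "\<And>r. r \<in> R \<Longrightarrow> r \<noteq> [] \<and> cyclically_reduced r" "w \<in> C_set R k"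
  shows "w \<noteq> [] \<and> cyclically_reduced w"
  using assms(2)
proof (induction k arbitrary: w rule: less_induct)
  case (less k)
  have conj: "x \<noteq> [] \<and> cyclically_reduced x"
    if "x \<in> cyclic_conjugates y" "y \<noteq> []" "cyclically_reduced y" for x y :: "'a word"
    using that cyclically_reduced_conjugate[of y x] by (auto simp: cyclic_conjugates_def)
  consider "k = 0" | "k = Suc 0" | j where "k = Suc (Suc j)"
    by (metis not0_implies_Suc)
  then show ?case
  proof cases
    case 1
    then show ?thesis using less by simp
  next
    case 2
    then show ?thesis using less(2) assms(1) conj by auto
  next
    case (3 j)
    then obtain u v where uv: "w \<in> cyclic_conjugates (cyc_red_prod u v)" "u \<noteq> word_inv v"
      "u \<in> C_set R (Suc j) \<and> v \<in> C_set R (Suc 0) \<or> u \<in> C_set R (Suc 0) \<and> v \<in> C_set R (Suc j)"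
      using less(2) by auto
    then have "reduced u" "reduced v"
      using less(1)[of "Suc j"] less(1)[of "Suc 0"] 3 by (auto simp: cyclically_reduced_def)
    then have "rho (u @ v) \<noteq> []" using uv(2) rho_append_eq_Nil by blast
    moreover obtain t where t: "rho (u @ v) = t @ cyc_red_prod u v @ word_inv t"
      using cyc_red_form(2)[of "u @ v"] unfolding cyc_red_prod_def by blast
    ultimately have "cyc_red_prod u v \<noteq> []"
      using reduced_rho[of "u @ v"] by (cases t rule: rev_cases) (auto simp: reduced_append reduced_Cons)
    then show ?thesis
      using conj uv(1) cyc_red_form(1)[of "u @ v"] unfolding cyc_red_prod_def by blast
  qed
qed

text \<open>
  The empty word is a relator (of area \<open>0\<close>) but lies in no \<open>D\<^sub>k\<close>.
\<close>

lemma Nil_notin_D_union: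
  assumes "\<And>r. r \<in> R \<Longrightarrow> r \<noteq> [] \<and> cyclically_reduced r"
  shows "[] \<notin> D_union X R"
proof -
  have "w \<noteq> []" if "in_D X R k w" for k w
    using that
  proof induction
    case (conj k w u)
    then show ?case using C_set_nonempty[OF assms] by auto
  next
    case (insert m n u w v)
    then show ?case by (auto simp: insertions_def)
  qed
  then show ?thesis by (auto simp: D_union_def D_set_def)
qed

end

theory Submission
  imports Defs
begin

text \<open>
  That elements of \<open>D\<^sub>k\<close> have area at most \<open>k\<close> is a direct computation. For the converse, a product of
  \<open>n\<close> conjugates of relators is read as an unreduced "cactus" word: a planar tree of edges and discs,
  built by inserting trivial pairs \<open>x x\<inverse>\<close> and boundary words of discs. Such words are closed under
  free cancellation: if the two cancelled letters belong to different discs, these are glued along that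
  letter. Hence the reduced word is itself a cactus word, and splitting off the disc inserted
  last exhibits it as an insertion of words of smaller area.

  The exception is a single disc containing all faces, which must be shown to lie in \<open>C\<^sub>n\<close>, that is, to
  grow one face at a time. To this end one disc \<open>u \<in> C\<^sub>k\<close> is distinguished. If no letter of \<open>u\<close> is ever
  cancelled against another disc, \<open>u\<close> survives in the reduced word and can be split off. Otherwise that
  letter lies on a single face \<open>c\<close> of the other disc; gluing only \<open>c\<close> to \<open>u\<close> gives an element
  of \<open>C\<^bsub>k+1\<^esub>\<close>, and the number of remaining faces drops.
\<close>

section \<open>Free reduction\<close>

lemma rho_cong: "rho u = rho u' \<Longrightarrow> rho v = rho v' \<Longrightarrow> rho (u @ v) = rho (u' @ v')"
  by (metis rho_rho_append1 rho_rho_append2)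

lemma rho_cong_middle: "rho u = rho u' \<Longrightarrow> rho (p @ u @ q) = rho (p @ u' @ q)"
  by (intro rho_cong refl)

lemma rho_word_inv_right: "rho (w @ word_inv w) = []"
  using rho_word_inv_left[of "word_inv w"] by simp

lemma rho_cancel_right [simp]: "rho (p @ g @ word_inv g @ q) = rho (p @ q)"
  using rho_cong_middle[of "g @ word_inv g" "[]" p q] by (simp add: rho_word_inv_right)

lemma rho_cancel_left [simp]: "rho (p @ word_inv g @ g @ q) = rho (p @ q)"
  using rho_cancel_right[of p "word_inv g" q] by simp

lemma rho_cancel_ends [simp]:
  "rho (g @ word_inv g @ q) = rho q" "rho (word_inv g @ g @ q) = rho q"
  "rho (p @ g @ word_inv g) = rho p" "rho (p @ word_inv g @ g) = rho p"
  using rho_cancel_right[of "[]" g q] rho_cancel_left[of "[]" g q]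
    rho_cancel_right[of p g "[]"] rho_cancel_left[of p g "[]"] by simp_all

lemma rho_word_inv_cong:
  assumes "rho u = rho v"
  shows "rho (word_inv u) = rho (word_inv v)"
proof -
  have "rho (word_inv u @ u @ word_inv v) = rho (word_inv u @ v @ word_inv v)"
    using assms by (rule rho_cong_middle)
  then show ?thesis by simp
qed

lemma not_reduced_cancel:
  assumes "\<not> reduced w"
  obtains p x q where "w = p @ x # letter_inv x # q"
proof -
  have "\<exists>p x q. w = p @ x # letter_inv x # q"
    using assms
  proof (induction w)
    case (Cons a w)
    show ?case
    proof (cases "reduced w")
      case True
      then have "w = letter_inv a # tl w"
        using Cons.prems by (cases w) (auto simp: reduced_Cons)
      then show ?thesis by (metis append_Nil)
    next
      case False
      then show ?thesis using Cons.IH by (metis append_Cons)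
    qed
  qed simp
  then show ?thesis using that by blast
qed

text \<open>The reduced form is reached by deleting cancelling pairs one at a time; each deletion
  shortens the word and preserves \<open>rho\<close>. Applied below to the property of being a
  cactus word.\<close>

lemma rho_closed_under_cancel:
  assumes "\<And>p x q. Q (p @ x # letter_inv x # q) \<Longrightarrow> Q (p @ q)" "Q w"
  shows "Q (rho w)"
  using assms(2)
proof (induction w rule: length_induct)
  case (1 w)
  show ?case
  proof (cases "reduced w")
    case True
    then show ?thesis using 1 by (simp add: rho_reduced)
  next
    case False
    then obtain p x q where w: "w = p @ x # letter_inv x # q"
      by (rule not_reduced_cancel)
    then have "Q (rho (p @ q))" using 1 assms(1) by auto
    then show ?thesis by (simp only: w rho_cancel)
  qed
qed

text \<open>Here \<open>b\<close> is the maximal part that cancels at the seam. It is needed when a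
  disc is cut out of a reduced word and the two remaining pieces meet.\<close>

lemma append_reduced_decomp:
  assumes "reduced p" "reduced q"
  obtains p' b q' where "p = p' @ b" "q = word_inv b @ q'" "reduced (p' @ q')"
proof -
  have "\<exists>p' b q'. p = p' @ b \<and> q = word_inv b @ q' \<and> reduced (p' @ q')"
    using assms
  proof (induction p arbitrary: q rule: rev_induct)
    case (snoc x p)
    show ?case
    proof (cases "reduced ((p @ [x]) @ q)")
      case True
      then show ?thesis by (intro exI[of _ "p @ [x]"] exI[of _ "[]"] exI[of _ q]) auto
    next
      case False
      then obtain q1 where q: "q = letter_inv x # q1"
        using snoc.prems by (cases q) (auto simp: reduced_append reduced_Cons)
      have "reduced p" "reduced q1"
        using snoc.prems q by (auto simp: reduced_append reduced_Cons)
      then obtain p' b q' where "p = p' @ b" "q1 = word_inv b @ q'" "reduced (p' @ q')"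
        using snoc.IH by blast
      then show ?thesis
        using q by (intro exI[of _ p'] exI[of _ "b @ [x]"] exI[of _ q']) auto
    qed
  next
    case Nil
    then show ?case by auto
  qed
  then show ?thesis using that by blast
qed

section \<open>Products of conjugates of relators\<close>

text \<open>Unlike \<open>Area\<close>, this allows unreduced conjugators and an unreduced
  \<open>w\<close>, and bounds the number of factors from above. It therefore depends only on the
  group element and is monotone in \<open>n\<close>.\<close>

definition area_le :: "'x set \<Rightarrow> 'x word set \<Rightarrow> nat \<Rightarrow> 'x word \<Rightarrow> bool" where
  "area_le X R n w \<longleftrightarrow> (\<exists>ps. length ps \<le> n \<and> set ps \<subseteq> words X \<times> R \<and>
     rho w = rho (concat (map (\<lambda>(a, r). a @ r @ word_inv a) ps)))"

lemma area_le_rho_cong: "rho u = rho v \<Longrightarrow> area_le X R n u \<Longrightarrow> area_le X R n v"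
  by (simp add: area_le_def)

lemma area_le_zero: "area_le X R 0 w \<longleftrightarrow> rho w = []"
  by (auto simp: area_le_def)

lemma area_le_Nil [simp]: "area_le X R n []"
  unfolding area_le_def by (intro exI[of _ "[]"]) auto

lemma area_le_relator:
  assumes "r \<in> R"
  shows "area_le X R (Suc 0) r"
  unfolding area_le_def using assms by (intro exI[of _ "[([], r)]"]) auto

lemma area_le_append:
  assumes "area_le X R m u" "area_le X R n v"
  shows "area_le X R (m + n) (u @ v)"
proof -
  obtain ps qs where "length ps \<le> m" "set ps \<subseteq> words X \<times> R"
      "rho u = rho (concat (map (\<lambda>(a, r). a @ r @ word_inv a) ps))"
      "length qs \<le> n" "set qs \<subseteq> words X \<times> R"
      "rho v = rho (concat (map (\<lambda>(a, r). a @ r @ word_inv a) qs))"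
    using assms by (auto simp: area_le_def)
  then show ?thesis
    unfolding area_le_def by (intro exI[of _ "ps @ qs"]) (auto intro: rho_cong)
qed

lemma rho_conj_concat:
  "rho (g @ concat (map (\<lambda>(a, r). a @ r @ word_inv a) ps) @ word_inv g) =
   rho (concat (map (\<lambda>(a, r). a @ r @ word_inv a) (map (\<lambda>(a, r). (g @ a, r)) ps)))"
proof (induction ps)
  case (Cons c ps)
  obtain a r where c: "c = (a, r)" by (cases c)
  let ?W = "\<lambda>ps. concat (map (\<lambda>(a, r). a @ r @ word_inv a) ps)"
  have "rho (g @ ?W (c # ps) @ word_inv g)
      = rho ((g @ a @ r @ word_inv a) @ word_inv g @ g @ ?W ps @ word_inv g)"
    \<comment> \<open>A trivial factor g^-1 g is placed between consecutive conjugates, so that each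
      one is conjugated separately.\<close>
    by (simp only: rho_cancel_left) (simp add: c)
  also have "\<dots> = rho (((g @ a @ r @ word_inv a) @ word_inv g) @ (g @ ?W ps @ word_inv g))"
    by simp
  also have "\<dots> = rho (((g @ a @ r @ word_inv a) @ word_inv g)
      @ ?W (map (\<lambda>(a, r). (g @ a, r)) ps))"
    using Cons.IH by (intro rho_cong refl)
  finally show ?case by (simp add: c)
qed (simp add: rho_word_inv_right)

lemma area_le_conj:
  assumes "area_le X R n u" "g \<in> words X"
  shows "area_le X R n (g @ u @ word_inv g)"
proof -
  obtain ps where ps: "length ps \<le> n" "set ps \<subseteq> words X \<times> R"
      "rho u = rho (concat (map (\<lambda>(a, r). a @ r @ word_inv a) ps))"
    using assms by (auto simp: area_le_def)
  have "rho (g @ u @ word_inv g) =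
      rho (g @ concat (map (\<lambda>(a, r). a @ r @ word_inv a) ps) @ word_inv g)"
    by (rule rho_cong_middle) (rule ps)
  also note rho_conj_concat
  finally show ?thesis
    unfolding area_le_def using ps assms(2)
    by (intro exI[of _ "map (\<lambda>(a, r). (g @ a, r)) ps"]) auto
qed

text \<open>In the group, p z q = (p z p^-1)(p q).\<close>

lemma area_le_insert:
  assumes "area_le X R m z" "area_le X R n (p @ q)" "p \<in> words X"
  shows "area_le X R (n + m) (p @ z @ q)"
proof -
  have "area_le X R (m + n) ((p @ z @ word_inv p) @ p @ q)"
    using assms by (intro area_le_append area_le_conj)
  then show ?thesis
    using area_le_rho_cong[of "(p @ z @ word_inv p) @ p @ q" "p @ z @ q"] rho_cancel_left[of "p @ z" p q]
    by (simp add: add.commute)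
qed

lemma area_le_rotate:
  assumes "area_le X R n (u @ v)" "v \<in> words X"
  shows "area_le X R n (v @ u)"
  using area_le_conj[OF assms] by (rule area_le_rho_cong[rotated]) (use rho_cancel_ends(3)[of "v @ u" v] in simp)

lemma words_UNIV [simp]: "w \<in> words UNIV"
  by (simp add: words_def)

text \<open>Over the full alphabet, conjugators need no membership checks; that the pieces lie in
  \<open>words X\<close> is later read off from the reduced word containing them.\<close>

lemma area_le_UNIV: "area_le X R n w \<Longrightarrow> area_le UNIV R n w"
  unfolding area_le_def by (fastforce simp: subset_iff)

lemma area_le_word_inv:
  assumes "word_inv ` R \<subseteq> R" "area_le X R n w"
  shows "area_le X R n (word_inv w)"
proof -
  obtain ps where ps: "length ps \<le> n" "set ps \<subseteq> words X \<times> R"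
      "rho w = rho (concat (map (\<lambda>(a, r). a @ r @ word_inv a) ps))"
    using assms by (auto simp: area_le_def)
  have "word_inv (concat (map (\<lambda>(a, r). a @ r @ word_inv a) ps)) =
      concat (map (\<lambda>(a, r). a @ r @ word_inv a) (rev (map (\<lambda>(a, r). (a, word_inv r)) ps)))"
    by (induction ps) auto
  then show ?thesis
    unfolding area_le_def using ps assms(1) rho_word_inv_cong[OF ps(3)]
    by (intro exI[of _ "rev (map (\<lambda>(a, r). (a, word_inv r)) ps)"]) auto
qed

lemma area_le_reduced_conjugators:
  assumes "area_le X R n w" "reduced w"
  obtains ps where "length ps \<le> n" "set ps \<subseteq> carrier (free_group X) \<times> R"
    "w = rho (concat (map (\<lambda>(a, r). a @ r @ word_inv a) ps))"
proof -
  obtain ps where ps: "length ps \<le> n" "set ps \<subseteq> words X \<times> R"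
      "rho w = rho (concat (map (\<lambda>(a, r). a @ r @ word_inv a) ps))"
    using assms by (auto simp: area_le_def)
  let ?qs = "map (\<lambda>(a, r). (rho a, r)) ps"
  have "rho (concat (map (\<lambda>(a, r). a @ r @ word_inv a) ps)) =
      rho (concat (map (\<lambda>(a, r). a @ r @ word_inv a) ?qs))"
  proof (induction ps)
    case (Cons c ps)
    obtain a r where c: "c = (a, r)" by (cases c)
    have "rho (a @ r @ word_inv a) = rho (rho a @ r @ word_inv (rho a))"
      by (intro rho_cong rho_word_inv_cong) (simp_all add: rho_reduced)
    from rho_cong[OF this Cons.IH] show ?case by (simp add: c)
  qed simp
  moreover have "set ?qs \<subseteq> carrier (free_group X) \<times> R"
    using ps(2) by (force simp: free_group_def rho_words)
  ultimately show ?thesis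
    using that[of ?qs] ps(1,3) assms(2) by (simp add: rho_reduced)
qed

text \<open>The reduced words over X of finite area form a normal subgroup \<open>N\<close>
  containing R, so \<open>N\<close> contains the normal closure. Closure of R under inverses gives
  closure of \<open>N\<close> under inverses.\<close>

lemma relator_area_le:
  assumes "R \<subseteq> words X" "\<And>r. r \<in> R \<Longrightarrow> reduced r" "word_inv ` R \<subseteq> R" "w \<in> relators X R"
  shows "\<exists>n. area_le X R n w" "w \<in> words X" "reduced w"
proof -
  define N where "N = {w \<in> words X. reduced w \<and> (\<exists>n. area_le X R n w)}"
  interpret group "free_group X" by (rule group_free_group)
  have inv: "inv\<^bsub>free_group X\<^esub> x = word_inv x" if "x \<in> words X" "reduced x" for x
    using that by (intro inv_equality) (auto simp: free_group_def rho_word_inv_left)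
  have area_rho: "area_le X R n (rho x) = area_le X R n x" for n x
    by (simp add: area_le_def rho_reduced)
  have "subgroup N (free_group X)"
  proof
    show "N \<subseteq> carrier (free_group X)" by (auto simp: N_def free_group_def)
    show "\<one>\<^bsub>free_group X\<^esub> \<in> N" by (auto simp: N_def free_group_def)
    show "x \<otimes>\<^bsub>free_group X\<^esub> y \<in> N" if "x \<in> N" "y \<in> N" for x y
      using that area_le_append[of X R _ x _ y]
      by (auto simp: N_def free_group_def area_rho rho_words)
    show "inv\<^bsub>free_group X\<^esub> x \<in> N" if "x \<in> N" for x
      using that area_le_word_inv[OF assms(3)] by (auto simp: N_def inv)
  qed
  moreover have "x \<otimes>\<^bsub>free_group X\<^esub> h \<otimes>\<^bsub>free_group X\<^esub> inv\<^bsub>free_group X\<^esub> x \<in> N"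
    if x: "x \<in> carrier (free_group X)" and h: "h \<in> N" for x h
  proof -
    have "x \<in> words X" "reduced x" "h \<in> words X" using x h by (auto simp: N_def free_group_def)
    moreover obtain n where "area_le X R n h" using h by (auto simp: N_def)
    ultimately show ?thesis
      using area_le_conj[of X R n h x] by (auto simp: N_def inv) (auto simp: free_group_def area_rho rho_words)
  qed
  ultimately have "N \<lhd> free_group X" by (simp add: normal_inv_iff)
  moreover have "R \<subseteq> N" using assms(1,2) area_le_relator by (fastforce simp: N_def)
  ultimately have "w \<in> N" using assms(4) by (auto simp: relators_def normal_closure_def)
  then show "\<exists>n. area_le X R n w" "w \<in> words X" "reduced w" by (auto simp: N_def)
qed

section \<open>The sets C and D consist of relators of bounded area\<close>

lemma self_cyclic_conjugate: "w \<in> cyclic_conjugates w"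
  unfolding cyclic_conjugates_def by (auto intro: exI[of _ "[]"])

lemma cyclic_conjugates_trans:
  assumes "u \<in> cyclic_conjugates v" "v \<in> cyclic_conjugates w"
  shows "u \<in> cyclic_conjugates w"
proof -
  obtain a b c d where "v = a @ b" "u = b @ a" "w = c @ d" "v = d @ c"
    using assms unfolding cyclic_conjugates_def by blast
  then have "\<exists>e. d = a @ e \<and> u = e @ c @ a \<and> w = (c @ a) @ e \<or> a = d @ e \<and> u = (b @ d) @ e \<and> w = e @ b @ d"
    by (auto simp: append_eq_append_conv2)
  then show ?thesis
    unfolding cyclic_conjugates_def by blast
qed

lemma cyclic_conjugates_rotate: "v @ u \<in> cyclic_conjugates w \<Longrightarrow> u @ v \<in> cyclic_conjugates w"
  by (rule cyclic_conjugates_trans) (auto simp: cyclic_conjugates_def)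

lemma C_set_cyclic_conjugate:
  assumes "u \<in> C_set R k" "v \<in> cyclic_conjugates u"
  shows "v \<in> C_set R k"
proof -
  have "\<exists>y. u \<in> cyclic_conjugates y \<and> cyclic_conjugates y \<subseteq> C_set R k"
  proof (cases k)
    case (Suc j)
    show ?thesis
    proof (cases j)
      case 0
      then show ?thesis using assms(1) Suc by auto
    next
      case (Suc i)
      show ?thesis
        using assms(1) unfolding \<open>k = Suc j\<close> Suc C_set.simps(3) by blast
    qed
  qed (use assms in simp)
  then show ?thesis using assms(2) cyclic_conjugates_trans by blast
qed

lemma C_set_rotate: "v @ u \<in> C_set R k \<Longrightarrow> u @ v \<in> C_set R k"
  by (erule C_set_cyclic_conjugate) (auto simp: cyclic_conjugates_def)

text \<open>A product u v adds the areas of its factors; passing to the cyclically reduced form and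
  then to a cyclic conjugate are conjugations, which do not increase the bound.\<close>

lemma C_set_area:
  assumes "R \<subseteq> words X" "w \<in> C_set R k"
  shows "w \<in> words X \<and> area_le X R k w"
  using assms(2)
proof (induction k arbitrary: w rule: less_induct)
  case (less k)
  have conj: "x \<in> words X \<and> area_le X R n x"
    if "x \<in> cyclic_conjugates y" "y \<in> words X" "area_le X R n y" for x y n
    using that area_le_rotate by (auto simp: cyclic_conjugates_def)
  consider "k = 0" | "k = Suc 0" | j where "k = Suc (Suc j)"
    by (metis not0_implies_Suc)
  then show ?case
  proof cases
    case 1
    then show ?thesis using less by simp
  next
    case 2
    then obtain r where r: "r \<in> R" "w \<in> cyclic_conjugates r" using less(2) by auto
    then show ?thesis using 2 conj[OF r(2), of 1] assms(1) area_le_relator[of r R X] by auto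
  next
    case (3 j)
    then obtain u v where uv: "w \<in> cyclic_conjugates (cyc_red_prod u v)"
      "u \<in> C_set R (Suc j) \<and> v \<in> C_set R (Suc 0) \<or> u \<in> C_set R (Suc 0) \<and> v \<in> C_set R (Suc j)"
      using less(2) by auto
    then have "u @ v \<in> words X" "area_le X R k (u @ v)"
      using less(1)[of "Suc j"] less(1)[of "Suc 0"] 3
        area_le_append[of X R "Suc j" u "Suc 0" v] area_le_append[of X R "Suc 0" u "Suc j" v]
      by auto
    moreover obtain t where t: "rho (u @ v) = t @ cyc_red_prod u v @ word_inv t"
      using cyc_red_form(2)[of "u @ v"] unfolding cyc_red_prod_def by blast
    ultimately have tw: "t \<in> words X" "cyc_red_prod u v \<in> words X"
      by (metis rho_words words_simps(3))+
    have "area_le X R k (t @ cyc_red_prod u v @ word_inv t)"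
      using \<open>area_le X R k (u @ v)\<close> by (rule area_le_rho_cong[rotated]) (simp add: t[symmetric] rho_reduced)
    then have "area_le X R k ((cyc_red_prod u v @ word_inv t) @ t)"
      using tw area_le_rotate[of X R k t "cyc_red_prod u v @ word_inv t"] by simp
    then have "area_le X R k (cyc_red_prod u v)"
      by (rule area_le_rho_cong[rotated]) simp
    then show ?thesis using conj uv(1) tw by blast
  qed
qed

lemma in_D_area:
  assumes "R \<subseteq> words X" "in_D X R k w"
  shows "w \<in> words X \<and> area_le X R k w"
  using assms(2)
proof induction
  case (conj k w u)
  then show ?case using C_set_area[OF assms(1), of w k] area_le_conj[of X R k w u] by simp
next
  case (insert m n u w v)
  then show ?case
    using area_le_insert[of X R m u n] by (auto simp: insertions_def add.commute)
qed


declare C_set.simps(2) [simp del]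

section \<open>Gluing two discs along a letter\<close>

lemma C_set_cyc_red_prod:
  assumes "k \<ge> 1" "u \<in> C_set R k" "v \<in> C_set R (Suc 0)" "u \<noteq> word_inv v"
    and "prefix (word_inv u) v \<or> suffix (word_inv v) u \<or>
      u \<noteq> [] \<and> v \<noteq> [] \<and> last u = letter_inv (hd v) \<and> hd u \<noteq> letter_inv (last v)"
  shows "cyc_red_prod u v \<in> C_set R (Suc k)"
proof -
  obtain j where k: "k = Suc j" using assms(1) by (cases k) auto
  show ?thesis
    unfolding k C_set.simps(3)
    using assms(2-) self_cyclic_conjugate[of "cyc_red_prod u v"] unfolding k by blast
qed

text \<open>The disc \<open>u @ s\<close> and the face \<open>word_inv s @ v\<close> share the arc
  \<open>s\<close>. The arc is lengthened, one letter of \<open>u\<close> at a time, until condition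
  (3) of the definition of \<open>C\<^sub>k\<close> holds. Full cancellation, excluded there by
  condition (2), gives \<open>y = []\<close>.\<close>

lemma C_set_glue:
  assumes "k \<ge> 1" "s \<noteq> []" "u @ s \<in> C_set R k" "word_inv s @ v \<in> C_set R (Suc 0)"
  shows "\<exists>y g. (y = [] \<or> y \<in> C_set R (Suc k)) \<and> rho (u @ v) = rho (g @ y @ word_inv g)"
  using assms(2-)
proof (induction u arbitrary: s v)
  case (Nil s v)
  show ?case
  proof (cases "v = []")
    case True
    then show ?thesis by (intro exI[of _ "[]"]) auto
  next
    case False
    \<comment> \<open>The arc is now the whole boundary of the disc, so the prefix clause
      applies.\<close>
    then have "cyc_red_prod s (word_inv s @ v) \<in> C_set R (Suc k)"
      using Nil assms(1) by (intro C_set_cyc_red_prod) (auto simp: append_eq_conv_conj)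
    moreover obtain t where t: "rho (s @ word_inv s @ v) =
        t @ cyc_red_prod s (word_inv s @ v) @ word_inv t"
      using cyc_red_form(2)[of "s @ word_inv s @ v"] unfolding cyc_red_prod_def by blast
    have "rho (rho v) = rho (t @ cyc_red_prod s (word_inv s @ v) @ word_inv t)"
      using t by simp
    ultimately show ?thesis by (auto simp: rho_reduced)
  qed
next
  case (Cons a u s v)
  show ?case
  proof (cases "v = [] \<or> last v \<noteq> letter_inv a")
    case True
    \<comment> \<open>If \<open>v = []\<close> the whole face lies along the disc and the suffix
      clause applies; otherwise the outer letters do not cancel, which is the third clause.\<close>
    have "cyc_red_prod ((a # u) @ s) (word_inv s @ v) \<in> C_set R (Suc k)"
    proof (rule C_set_cyc_red_prod)
      show "(a # u) @ s \<noteq> word_inv (word_inv s @ v)"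
      proof
        assume eq: "(a # u) @ s = word_inv (word_inv s @ v)"
        then have "a # u = word_inv v" by simp
        then have "v = word_inv (a # u)" by (metis word_inv_inv)
        then show False using True by simp
      qed
      have "last v = letter_inv b \<longleftrightarrow> b = letter_inv (last v)" for b
        by (metis letter_inv_inv)
      then show "prefix (word_inv ((a # u) @ s)) (word_inv s @ v) \<or>
          suffix (word_inv (word_inv s @ v)) ((a # u) @ s) \<or>
          (a # u) @ s \<noteq> [] \<and> word_inv s @ v \<noteq> [] \<and>
          last ((a # u) @ s) = letter_inv (hd (word_inv s @ v)) \<and>
          hd ((a # u) @ s) \<noteq> letter_inv (last (word_inv s @ v))"
        using True Cons.prems(1)
        by (cases "v = []"; cases s rule: rev_cases) (auto simp: suffix_def)
    qed (use Cons.prems assms(1) in auto)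
    moreover obtain t where t: "rho (((a # u) @ s) @ word_inv s @ v) =
        t @ cyc_red_prod ((a # u) @ s) (word_inv s @ v) @ word_inv t"
      using cyc_red_form(2)[of "((a # u) @ s) @ word_inv s @ v"] unfolding cyc_red_prod_def by blast
    have "rho (rho ((a # u) @ v)) = rho (t @ cyc_red_prod ((a # u) @ s) (word_inv s @ v) @ word_inv t)"
      using t rho_cancel_right[of "a # u" s v] by simp
    ultimately show ?thesis
      by (metis reduced_rho rho_reduced)
  next
    case False
    then obtain v' where v: "v = v' @ [letter_inv a]"
      by (cases v rule: rev_cases) auto
    \<comment> \<open>The outer letters cancel. Rotating both words appends \<open>a\<close> to the
      shared arc, and the resulting element is conjugated by \<open>a\<close> afterwards.\<close>
    have "u @ s @ [a] \<in> C_set R k"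
      using Cons.prems(2) C_set_rotate[of "[a]" "u @ s"] by simp
    moreover have "word_inv (s @ [a]) @ v' \<in> C_set R (Suc 0)"
      using Cons.prems(3) C_set_rotate[of "word_inv s @ v'" "[letter_inv a]"] v
      by simp
    ultimately obtain y g where y: "y = [] \<or> y \<in> C_set R (Suc k)"
        "rho (u @ v') = rho (g @ y @ word_inv g)"
      using Cons.IH[of "s @ [a]" v'] by auto
    from rho_cong_middle[OF y(2), of "[a]" "[letter_inv a]"]
    have "rho ((a # u) @ v) = rho ((a # g) @ y @ word_inv (a # g))" using v by simp
    then show ?thesis using y(1) by blast
  qed
qed

section \<open>Positions of letters in products, and discs with counted faces\<close>

lemma append_eq_append_Cons_cases:
  assumes "p @ q = s @ x # t"
  obtains (left) p' where "p = s @ x # p'" "t = p' @ q"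
    | (right) s' where "q = s' @ x # t" "s = p @ s'"
proof -
  obtain us where "p = s @ us \<and> us @ q = x # t \<or> p @ us = s \<and> q = us @ x # t"
    using assms unfolding append_eq_append_conv2 by blast
  then show ?thesis using that by (cases us) auto
qed

lemma append3_eq_append_Cons_cases:
  assumes "p @ v @ q = s @ x # t"
  obtains (left) p' where "p = s @ x # p'" "t = p' @ v @ q"
    | (middle) v1 v2 where "v = v1 @ x # v2" "s = p @ v1" "t = v2 @ q"
    | (right) s' where "q = s' @ x # t" "s = p @ v @ s'"
  using assms
proof (cases rule: append_eq_append_Cons_cases)
  case outer: (right s')
  from outer(1) show ?thesis
    by (cases rule: append_eq_append_Cons_cases) (use that outer in auto)
qed (use that in blast)

text \<open>
  This replaces van Kampen diagrams: \<open>y\<close> bounds a disc with \<open>m\<close> faces insofar as every letter \<open>b\<close> of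
  it lies on a face \<open>b c\<close> whose removal leaves a word of area at most \<open>m - 1\<close>.
\<close>

definition face_disc :: "'x word set \<Rightarrow> nat \<Rightarrow> 'x word \<Rightarrow> bool" where
  "face_disc R m y \<longleftrightarrow> (\<forall>y1 b y2. y = y1 @ b # y2 \<longrightarrow>
     (\<exists>m' c. m = Suc m' \<and> b # c \<in> C_set R (Suc 0) \<and> area_le UNIV R m' (word_inv c @ y2 @ y1)))"

lemma face_discD:
  assumes "face_disc R m (y1 @ b # y2)"
  obtains m' c where "m = Suc m'" "b # c \<in> C_set R (Suc 0)"
    "area_le UNIV R m' (word_inv c @ y2 @ y1)"
  using assms unfolding face_disc_def by blast

lemma area_le_face: "c \<in> C_set R (Suc 0) \<Longrightarrow> area_le UNIV R (Suc 0) c"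
  using C_set_area[of R UNIV c "Suc 0"] by (simp add: subset_iff)

text \<open>In the group, b y2 = (b c)(c^-1 y2): one face times a word of area at most
  \<open>m - 1\<close>. The empty word is vacuously a disc for every \<open>m\<close>.\<close>

lemma face_disc_area:
  assumes "face_disc R m y"
  shows "area_le UNIV R m y"
proof (cases y)
  case (Cons b y2)
  then obtain m' c where c: "m = Suc m'" "b # c \<in> C_set R (Suc 0)"
      "area_le UNIV R m' (word_inv c @ y2)"
    using face_discD[of R m "[]" b y2] assms by auto
  have "area_le UNIV R (Suc 0 + m') ((b # c) @ word_inv c @ y2)"
    using c by (intro area_le_append area_le_face)
  then have "area_le UNIV R m ((b # c) @ word_inv c @ y2)" using c(1) by simp
  then show ?thesis
    unfolding Cons by (rule area_le_rho_cong[rotated]) (use rho_cancel_right[of "[b]" c y2] in simp)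
qed simp

lemma face_disc_face:
  assumes "y \<in> C_set R (Suc 0)"
  shows "face_disc R (Suc 0) y"
  unfolding face_disc_def
proof (intro allI impI)
  fix y1 b y2 assume "y = y1 @ b # y2"
  \<comment> \<open>The removed face is the whole disc, so c = y2 y1 and the rest is
    trivial.\<close>
  then have "b # y2 @ y1 \<in> C_set R (Suc 0)"
    using assms C_set_rotate[of y1 "b # y2" R "Suc 0"] by simp
  then show "\<exists>m' c. Suc 0 = Suc m' \<and> b # c \<in> C_set R (Suc 0) \<and>
      area_le UNIV R m' (word_inv c @ y2 @ y1)"
    using rho_word_inv_left[of "y2 @ y1"]
    by (intro exI[of _ 0] exI[of _ "y2 @ y1"]) (simp add: area_le_zero)
qed

lemma face_disc_rotate:
  assumes "face_disc R m (u @ v)"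
  shows "face_disc R m (v @ u)"
  unfolding face_disc_def
proof (intro allI impI)
  fix y1 b y2 assume "v @ u = y1 @ b # y2"
  then consider t where "v = y1 @ b # t" "y2 = t @ u" | t where "u = t @ b # y2" "y1 = v @ t"
    by (rule append_eq_append_Cons_cases)
  then show "\<exists>m' c. m = Suc m' \<and> b # c \<in> C_set R (Suc 0) \<and>
      area_le UNIV R m' (word_inv c @ y2 @ y1)"
  proof cases
    case 1
    then have "face_disc R m ((u @ y1) @ b # t)" using assms by simp
    then show ?thesis by (rule face_discD) (use 1 in auto)
  next
    case 2
    then have "face_disc R m (t @ b # y2 @ v)" using assms by simp
    then show ?thesis by (rule face_discD) (use 2 in auto)
  qed
qed

lemma face_disc_cancel:
  assumes "face_disc R m (p @ x # letter_inv x # q)"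
  shows "face_disc R m (p @ q)"
  unfolding face_disc_def
proof (intro allI impI)
  fix y1 b y2 assume "p @ q = y1 @ b # y2"
  then consider t where "p = y1 @ b # t" "y2 = t @ q" | t where "q = t @ b # y2" "y1 = p @ t"
    by (rule append_eq_append_Cons_cases)
  then show "\<exists>m' c. m = Suc m' \<and> b # c \<in> C_set R (Suc 0) \<and>
      area_le UNIV R m' (word_inv c @ y2 @ y1)"
  proof cases
    case 1
    then have "face_disc R m ((y1) @ b # (t @ x # letter_inv x # q))" using assms by simp
    then obtain m' c where c: "m = Suc m'" "b # c \<in> C_set R (Suc 0)"
        "area_le UNIV R m' (word_inv c @ (t @ x # letter_inv x # q) @ y1)"
      by (rule face_discD)
    from c(3) have "area_le UNIV R m' (word_inv c @ y2 @ y1)"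
      by (rule area_le_rho_cong[rotated])
        (use 1 rho_cancel[of "word_inv c @ t" x "q @ y1"] in simp)
    then show ?thesis using c(1,2) by blast
  next
    case 2
    then have "face_disc R m ((p @ x # letter_inv x # t) @ b # (y2))" using assms by simp
    then obtain m' c where c: "m = Suc m'" "b # c \<in> C_set R (Suc 0)"
        "area_le UNIV R m' (word_inv c @ y2 @ p @ x # letter_inv x # t)"
      by (rule face_discD)
    from c(3) have "area_le UNIV R m' (word_inv c @ y2 @ y1)"
      by (rule area_le_rho_cong[rotated])
        (use 2 rho_cancel[of "word_inv c @ y2 @ p" x t] in simp)
    then show ?thesis using c(1,2) by blast
  qed
qed

text \<open>Insert the relator x^-1 z directly after \<open>x\<close> and cancel.\<close>

lemma area_le_replace_letter:
  assumes "area_le UNIV R m (p @ x # q)" "area_le UNIV R n (letter_inv x # z)"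
  shows "area_le UNIV R (m + n) (p @ z @ q)"
proof -
  have "area_le UNIV R (m + n) ((p @ [x]) @ (letter_inv x # z) @ q)"
    using assms by (intro area_le_insert) auto
  then show ?thesis
    by (rule area_le_rho_cong[rotated]) (use rho_cancel[of p x "z @ q"] in simp)
qed

text \<open>The face at a letter \<open>b\<close> is taken from the disc that carries
  \<open>b\<close>. The other disc is then glued as a whole to what remains, adding its
  area.\<close>

lemma face_disc_glue:
  assumes E: "face_disc R m (p @ x # q)" "face_disc R n (letter_inv x # z)"
  shows "face_disc R (m + n) (p @ z @ q)"
  unfolding face_disc_def
proof (intro allI impI)
  fix y1 b y2 assume "p @ z @ q = y1 @ b # y2"
  then consider t where "p = y1 @ b # t" "y2 = t @ z @ q"
    | t t' where "z = t @ b # t'" "y1 = p @ t" "y2 = t' @ q"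
    | t where "q = t @ b # y2" "y1 = p @ z @ t"
    by (rule append3_eq_append_Cons_cases)
  then show "\<exists>m' c. m + n = Suc m' \<and> b # c \<in> C_set R (Suc 0) \<and>
      area_le UNIV R m' (word_inv c @ y2 @ y1)"
  proof cases
    case 1
    then have "face_disc R m ((y1) @ b # (t @ x # q))" using E(1) by simp
    then obtain m' c where c: "m = Suc m'" "b # c \<in> C_set R (Suc 0)"
        "area_le UNIV R m' (word_inv c @ (t @ x # q) @ y1)"
      by (rule face_discD)
    have "area_le UNIV R (m' + n) ((word_inv c @ t) @ z @ q @ y1)"
      by (rule area_le_replace_letter[OF _ face_disc_area[OF E(2)]]) (use c in simp)
    then show ?thesis
      using 1 c by (intro exI[of _ "m' + n"] exI[of _ c]) simp
  next
    case 2
    then have "face_disc R n ((letter_inv x # t) @ b # (t'))" using E(2) by simp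
    then obtain n' c where c: "n = Suc n'" "b # c \<in> C_set R (Suc 0)"
        "area_le UNIV R n' (word_inv c @ t' @ letter_inv x # t)"
      by (rule face_discD)
    \<comment> \<open>The letter lies on the second disc: the roles are exchanged, and
      \<open>letter_inv x\<close> is replaced by the rest q p of the first boundary.\<close>
    have rotated: "area_le UNIV R m ((x # q) @ p)"
      by (rule area_le_rotate) (use face_disc_area[OF E(1)] in auto)
    have "area_le UNIV R (n' + m) ((word_inv c @ t') @ (q @ p) @ t)"
      by (rule area_le_replace_letter[of _ _ _ "letter_inv x"]) (use c rotated in auto)
    then show ?thesis
      using 2 c by (intro exI[of _ "n' + m"] exI[of _ c]) (simp add: add.commute)
  next
    case 3
    then have "face_disc R m ((p @ x # t) @ b # (y2))" using E(1) by simp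
    then obtain m' c where c: "m = Suc m'" "b # c \<in> C_set R (Suc 0)"
        "area_le UNIV R m' (word_inv c @ y2 @ p @ x # t)"
      by (rule face_discD)
    have "area_le UNIV R (m' + n) ((word_inv c @ y2 @ p) @ z @ t)"
      by (rule area_le_replace_letter[OF _ face_disc_area[OF E(2)]]) (use c in simp)
    then show ?thesis
      using 3 c by (intro exI[of _ "m' + n"] exI[of _ c]) simp
  qed
qed


section \<open>Cactus words\<close>

text \<open>
  The first weight counts occurrences of the distinguished disc, the second the faces of the others.
\<close>

inductive cactus :: "(nat \<Rightarrow> nat \<Rightarrow> 'x word \<Rightarrow> bool) \<Rightarrow> nat \<Rightarrow> nat \<Rightarrow> 'x word \<Rightarrow> bool"
  for P :: "nat \<Rightarrow> nat \<Rightarrow> 'x word \<Rightarrow> bool" where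
  nil: "cactus P 0 0 []"
| pair: "cactus P a i (p @ q) \<Longrightarrow> cactus P a i (p @ [x, letter_inv x] @ q)"
| disc: "P b j z \<Longrightarrow> cactus P a i (p @ q) \<Longrightarrow> cactus P (a + b) (i + j) (p @ z @ q)"

lemma cactus_insert_inverse:
  "cactus P a i (p @ q) \<Longrightarrow> cactus P a i (p @ g @ word_inv g @ q)"
proof (induction g arbitrary: p q)
  case (Cons x g)
  have "cactus P a i (p @ [x, letter_inv x] @ q)" using Cons.prems by (rule cactus.pair)
  then show ?case using Cons.IH[of "p @ [x]" "letter_inv x # q"] by simp
qed simp

lemma cactus_insert_conj:
  assumes "P b j z" "cactus P a i q"
  shows "cactus P (a + b) (i + j) (g @ z @ word_inv g @ q)"
  using cactus.disc[of P b j z a i g "word_inv g @ q"] cactus_insert_inverse[of P a i "[]" q g] assms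
  by simp

text \<open>These are the closure properties that free cancellation in a cactus word requires:
  \<open>cancel\<close> for two letters of one disc, \<open>glue\<close> for letters of different
  discs, and \<open>rotate\<close> to bring the gluing letter to the front.\<close>

locale closed_discs =
  fixes P :: "nat \<Rightarrow> nat \<Rightarrow> 'x word \<Rightarrow> bool"
  assumes rotate: "P a i (u @ v) \<Longrightarrow> P a i (v @ u)"
    and cancel: "P a i (u @ x # letter_inv x # v) \<Longrightarrow> P a i (u @ v)"
    and glue: "P a i (u @ x # v) \<Longrightarrow> P b j (letter_inv x # z) \<Longrightarrow> P (a + b) (i + j) (u @ z @ v)"
begin

text \<open>Gluing a disc along \<open>x\<close> to whatever carries \<open>x\<close>. On an
  inserted pair, the new disc takes over that edge and becomes the inserted word; on a disc, the two
  are merged.\<close>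

lemma cactus_replace_letter:
  assumes "cactus P a i (s @ x # t)" "P b j (letter_inv x # z)"
  shows "cactus P (a + b) (i + j) (s @ z @ t)"
  using assms(1)
proof (induction a i "s @ x # t" arbitrary: s t rule: cactus.induct)
  case (pair a i p q y)
  from pair.hyps(3) show ?case
  proof (cases rule: append3_eq_append_Cons_cases)
    case (left p')
    then have "cactus P (a + b) (i + j) ((s @ z @ p') @ q)" using pair.hyps(2)[of s "p' @ q"] by simp
    from cactus.pair[OF this, of y] show ?thesis using left by simp
  next
    case (middle v1 v2)
    consider "v1 = []" "x = y" "v2 = [letter_inv y]" | "v1 = [y]" "x = letter_inv y" "v2 = []"
      using middle(1) by (cases v1) (auto simp: Cons_eq_append_conv)
    then show ?thesis
    proof cases
      case 1
      then have "P b j (z @ [letter_inv y])" using rotate[of b j "[letter_inv y]" z] assms(2) by simp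
      from cactus.disc[OF this pair.hyps(1)] show ?thesis using 1 middle by simp
    next
      case 2
      then show ?thesis using cactus.disc[OF assms(2) pair.hyps(1)] middle by simp
    qed
  next
    case (right s')
    then have "cactus P (a + b) (i + j) (p @ s' @ z @ t)" using pair.hyps(2)[of "p @ s'" t] by simp
    from cactus.pair[OF this, of y] show ?thesis using right by simp
  qed
next
  case (disc b' j' y a i p q)
  from disc.hyps(4) show ?case
  proof (cases rule: append3_eq_append_Cons_cases)
    case (left p')
    then have "cactus P (a + b) (i + j) ((s @ z @ p') @ q)" using disc.hyps(3)[of s "p' @ q"] by simp
    from cactus.disc[OF disc.hyps(1) this] show ?thesis using left by (simp add: ac_simps)
  next
    case (middle v1 v2)
    then have "P (b' + b) (j' + j) (v1 @ z @ v2)" using disc.hyps(1) assms(2) by (auto intro: glue)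
    from cactus.disc[OF this disc.hyps(2)] show ?thesis using middle by (simp add: ac_simps)
  next
    case (right s')
    then have "cactus P (a + b) (i + j) (p @ s' @ z @ t)" using disc.hyps(3)[of "p @ s'" t] by simp
    from cactus.disc[OF disc.hyps(1) this] show ?thesis using right by (simp add: ac_simps)
  qed
qed simp

lemma cactus_cancel:
  assumes "cactus P a i (s @ x # letter_inv x # t)"
  shows "cactus P a i (s @ t)"
  using assms
proof (induction a i "s @ x # letter_inv x # t" arbitrary: s t rule: cactus.induct)
  case (pair a i p q y)
  from pair.hyps(3) show ?case
  proof (cases rule: append3_eq_append_Cons_cases)
    case (left p')
    show ?thesis
    proof (cases p')
      \<comment> \<open>The word reads x x^-1 x here; deleting the first two letters leaves the same
        word as deleting the inserted pair.\<close>
      case Nil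
      then have "y = letter_inv x" using left by simp
      then show ?thesis using pair.hyps(1) left Nil by simp
    next
      case (Cons c p'')
      then have "cactus P a i ((s @ p'') @ q)" using pair.hyps(2)[of s "p'' @ q"] left by simp
      from cactus.pair[OF this, of y] show ?thesis using left Cons by simp
    qed
  next
    case (middle v1 v2)
    consider "v1 = []" "x = y" "v2 = [letter_inv y]" | "v1 = [y]" "x = letter_inv y" "v2 = []"
      using middle(1) by (cases v1) (auto simp: Cons_eq_append_conv)
    then show ?thesis by cases (use pair.hyps(1) middle in auto)
  next
    case (right s')
    then have "cactus P a i (p @ s' @ t)" using pair.hyps(2)[of "p @ s'" t] by simp
    from cactus.pair[OF this, of y] show ?thesis using right by simp
  qed
next
  case (disc b j z a i p q)
  from disc.hyps(4) show ?case
  proof (cases rule: append3_eq_append_Cons_cases)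
    case (left p')
    show ?thesis
    proof (cases p')
      \<comment> \<open>Now \<open>x\<close> stands directly before the inserted disc. If that disc
        is empty the pair lies in \<open>p @ q\<close>; otherwise the disc begins with
        \<open>letter_inv x\<close> and is glued along it.\<close>
      case Nil
      show ?thesis
      proof (cases z)
        case z: Nil
        then have "cactus P a i (s @ t)" using disc.hyps(3)[of s t] left Nil by simp
        from cactus.disc[OF disc.hyps(1) this] show ?thesis using z by simp
      next
        case (Cons c z')
        then show ?thesis
          using cactus_replace_letter[of a i s x q b j z'] disc.hyps(1,2) left Nil by simp
      qed
    next
      case (Cons c p'')
      then have "cactus P a i ((s @ p'') @ q)" using disc.hyps(3)[of s "p'' @ q"] left by simp
      from cactus.disc[OF disc.hyps(1) this] show ?thesis using left Cons by simp
    qed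
  next
    case (middle v1 v2)
    show ?thesis
    proof (cases v2)
      case Nil
      \<comment> \<open>The pair straddles the end of the inserted disc, which is rotated to begin
        with \<open>x\<close>.\<close>
      then have "P b j (x # v1)" using disc.hyps(1) middle(1) rotate[of b j v1 "[x]"] by simp
      then show ?thesis
        using cactus_replace_letter[of a i p "letter_inv x" t b j v1] disc.hyps(2) middle Nil by simp
    next
      case (Cons c v3)
      then have "P b j (v1 @ v3)" using disc.hyps(1) middle cancel[of b j v1 x v3] by simp
      from cactus.disc[OF this disc.hyps(2)] show ?thesis using middle Cons by simp
    qed
  next
    case (right s')
    then have "cactus P a i (p @ s' @ t)" using disc.hyps(3)[of "p @ s'" t] by simp
    from cactus.disc[OF disc.hyps(1) this] show ?thesis using right by simp
  qed
qed simp

lemma cactus_rho: "cactus P a i w \<Longrightarrow> cactus P a i (rho w)"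
  by (rule rho_closed_under_cancel) (rule cactus_cancel)

end

section \<open>Growing a distinguished disc\<close>

text \<open>A group-level record: one conjugate of a seed from \<open>S\<close>, with area at most
  \<open>i\<close> spent on everything else.\<close>

definition seeded :: "'x word set \<Rightarrow> 'x word set \<Rightarrow> nat \<Rightarrow> 'x word \<Rightarrow> bool" where
  "seeded R S i z \<longleftrightarrow> (\<exists>u g h. u \<in> S \<and> rho z = rho (g @ u @ word_inv g @ h) \<and> area_le UNIV R i h)"

lemma seeded_rho_cong: "rho u = rho v \<Longrightarrow> seeded R S i u \<Longrightarrow> seeded R S i v"
  by (simp add: seeded_def)

lemma seeded_insert_Nil:
  assumes "seeded R (insert [] S) i z"
  shows "seeded R S i z \<or> area_le UNIV R i z"
proof -
  obtain u g h where u: "u = [] \<or> u \<in> S" "rho z = rho (g @ u @ word_inv g @ h)" "area_le UNIV R i h"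
    using assms unfolding seeded_def by blast
  then consider "u \<in> S" | "rho h = rho z" by fastforce
  then show ?thesis
  proof cases
    case 1
    then show ?thesis using u(2,3) unfolding seeded_def by blast
  next
    case 2
    then show ?thesis using u(3) area_le_rho_cong by blast
  qed
qed

lemma seeded_append:
  assumes "seeded R S i z" "area_le UNIV R n v"
  shows "seeded R S (i + n) (z @ v)"
proof -
  obtain u g h where u: "u \<in> S" "rho z = rho (g @ u @ word_inv g @ h)" "area_le UNIV R i h"
    using assms(1) by (auto simp: seeded_def)
  have "rho (z @ v) = rho (g @ u @ word_inv g @ h @ v)"
    using rho_cong[OF u(2) refl, of v] by simp
  then show ?thesis
    unfolding seeded_def using u(1) area_le_append[OF u(3) assms(2)] by blast
qed

lemma seeded_conj:
  assumes "seeded R S i z"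
  shows "seeded R S i (f @ z @ word_inv f)"
proof -
  obtain u g h where u: "u \<in> S" "rho z = rho (g @ u @ word_inv g @ h)" "area_le UNIV R i h"
    using assms(1) by (auto simp: seeded_def)
  have "rho (f @ z @ word_inv f) = rho ((f @ g @ u @ word_inv g) @ h @ word_inv f)"
    using rho_cong_middle[OF u(2), of f "word_inv f"] by simp
  also have "\<dots> = rho ((f @ g @ u @ word_inv g) @ word_inv f @ f @ h @ word_inv f)"
    by (simp only: rho_cancel_left)
  finally have "rho (f @ z @ word_inv f) =
      rho ((f @ g) @ u @ word_inv (f @ g) @ (f @ h @ word_inv f))" by simp
  then show ?thesis
    unfolding seeded_def using u(1) area_le_conj[OF u(3) words_UNIV, of f] by blast
qed

lemma seeded_rotate:
  assumes "seeded R S i (u @ v)"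
  shows "seeded R S i (v @ u)"
  using seeded_conj[OF assms, of v]
  by (rule seeded_rho_cong[rotated]) (use rho_cancel_ends(3)[of "v @ u" v] in simp)

lemma seeded_insert:
  assumes "seeded R S i z" "area_le UNIV R n (p @ q)"
  shows "seeded R S (i + n) (p @ z @ q)"
  using seeded_append[OF seeded_conj[OF assms(1), of p] assms(2)]
  by (rule seeded_rho_cong[rotated]) (use rho_cancel_left[of "p @ z" p q] in simp)

lemma insert_seeded:
  assumes "seeded R S i (p @ q)" "area_le UNIV R n z"
  shows "seeded R S (i + n) (p @ z @ q)"
proof -
  have "seeded R S (i + n) ((q @ p) @ z)"
    using assms by (intro seeded_append) (rule seeded_rotate)
  then show ?thesis using seeded_rotate[of R S _ q "p @ z"] by simp
qed

text \<open>
  Once a face has been glued to \<open>u\<close> (third equation), only the group element is remembered. The empty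
  word is added to \<open>C\<^bsub>k+1\<^esub>\<close> because that face may cancel \<open>u\<close> completely. A first weight of at least
  \<open>2\<close> does not occur in the application.
\<close>

fun seed_disc :: "'x word set \<Rightarrow> nat \<Rightarrow> 'x word \<Rightarrow> nat \<Rightarrow> nat \<Rightarrow> 'x word \<Rightarrow> bool" where
  "seed_disc R k u 0 i z = face_disc R i z"
| "seed_disc R k u (Suc 0) 0 z = (z \<in> cyclic_conjugates u)"
| "seed_disc R k u (Suc 0) (Suc i) z = seeded R (insert [] (C_set R (Suc k))) i z"
| "seed_disc R k u (Suc (Suc a)) i z = True"

text \<open>If the seed is still untouched, only the face \<open>c\<close> of the other disc at the
  gluing letter is attached to it. The rest c^-1 z of that disc has one face less and joins the
  remainder.\<close>

lemma seed_disc_glue_face: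
  assumes "k \<ge> 1" "u \<in> C_set R k"
    and "seed_disc R k u (Suc 0) i (p @ x # q)" "face_disc R j (letter_inv x # z)"
  shows "seed_disc R k u (Suc 0) (i + j) (p @ z @ q)"
proof (cases i)
  case 0
  have "face_disc R j ([] @ letter_inv x # z)" using assms(4) by simp
  then obtain j' c where c: "j = Suc j'" "letter_inv x # c \<in> C_set R (Suc 0)"
      "area_le UNIV R j' (word_inv c @ z @ [])"
    by (rule face_discD)
  have "p @ x # q \<in> C_set R k" using assms(2,3) 0 C_set_cyclic_conjugate by simp
  then have "(q @ p) @ [x] \<in> C_set R k" using C_set_rotate[of "p @ [x]" q] by simp
  then obtain y g where y: "y = [] \<or> y \<in> C_set R (Suc k)"
      "rho ((q @ p) @ c) = rho (g @ y @ word_inv g)"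
    using C_set_glue[of k "[x]" "q @ p" R c] assms(1) c(2) by auto
  then have "seeded R (insert [] (C_set R (Suc k))) 0 (q @ p @ c)"
    unfolding seeded_def
    by (intro exI[of _ y] exI[of _ g] exI[of _ "[]"]) auto
  then have "seeded R (insert [] (C_set R (Suc k))) 0 ((p @ c) @ q)"
    by (rule seeded_rotate)
  from insert_seeded[OF this c(3)]
  have "seeded R (insert [] (C_set R (Suc k))) j' ((p @ c) @ (word_inv c @ z @ []) @ q)" by simp
  then have "seeded R (insert [] (C_set R (Suc k))) j' (p @ z @ q)"
    by (rule seeded_rho_cong[rotated]) simp
  \<comment> \<open>The face \<open>c\<close> is counted in the second weight \<open>Suc j'\<close>
    but already belongs to the new seed, whence \<open>seeded\<close> with
    \<open>j'\<close>.\<close>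
  then show ?thesis using 0 c(1) by simp
next
  case (Suc i')
  then have "seeded R (insert [] (C_set R (Suc k))) i' ((p @ [x]) @ q)" using assms(3) by simp
  from insert_seeded[OF this face_disc_area[OF assms(4)]]
  have "seeded R (insert [] (C_set R (Suc k))) (i' + j) (p @ z @ q)"
    by (rule seeded_rho_cong[rotated]) (use rho_cancel[of p x "z @ q"] in simp)
  then show ?thesis using Suc by simp
qed

lemma seed_disc_rotate:
  assumes "seed_disc R k u a i (v @ w)"
  shows "seed_disc R k u a i (w @ v)"
  using assms face_disc_rotate[of R i v w] cyclic_conjugates_rotate[of v w u] seeded_rotate[of R _ _ v w]
  by (cases "(R, k, u, a, i, v @ w)" rule: seed_disc.cases) auto

lemma closed_discs_seed_disc:
  assumes "k \<ge> 1" "u \<in> C_set R k" "cyclically_reduced u"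
  shows "closed_discs (seed_disc R k u)"
proof
  show "seed_disc R k u a i (w @ v)" if "seed_disc R k u a i (v @ w)" for a i v w
    using that by (rule seed_disc_rotate)
next
  fix a i v x w assume P: "seed_disc R k u a i (v @ x # letter_inv x # w)"
  \<comment> \<open>No cancellation can occur inside an untouched seed, since it is a cyclic
    conjugate of a cyclically reduced word.\<close>
  have "reduced z" if "z \<in> cyclic_conjugates u" for z
    using cyclically_reduced_conjugate[OF assms(3) that] by (simp add: cyclically_reduced_def)
  then have "v @ x # letter_inv x # w \<notin> cyclic_conjugates u"
    by (metis list.sel(1) list.distinct(1) reduced_Cons reduced_append)
  then show "seed_disc R k u a i (v @ w)"
    using P seeded_rho_cong[OF rho_cancel[of v x w]] face_disc_cancel[of R i v x w]
    by (cases "(R, k, u, a, i, v @ w)" rule: seed_disc.cases) auto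
next
  fix a i v x w b j z
  assume P: "seed_disc R k u a i (v @ x # w)" "seed_disc R k u b j (letter_inv x # z)"
  consider "a = 0" "b = 0" | "a = Suc 0" "b = 0" | "a = 0" "b = Suc 0" | c where "a + b = Suc (Suc c)"
    by (cases a; cases b; cases "a - 1"; cases "b - 1") auto
  then show "seed_disc R k u (a + b) (i + j) (v @ z @ w)"
  proof cases
    case 1
    then show ?thesis using P face_disc_glue[of R i v x w j z] by simp
  next
    case 2
    then show ?thesis using P seed_disc_glue_face[OF assms(1,2)] by simp
  next
    case 3
    have "seed_disc R k u (Suc 0) j (z @ letter_inv x # [])"
      using P(2) 3 seed_disc_rotate[of R k u "Suc 0" j "[letter_inv x]" z] by simp
    moreover have "face_disc R i (letter_inv (letter_inv x) # (w @ v))"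
      using P(1) 3 face_disc_rotate[of R i v "x # w"] by simp
    ultimately have "seed_disc R k u (Suc 0) (j + i) (z @ (w @ v) @ [])"
      by (rule seed_disc_glue_face[OF assms(1,2)])
    then show ?thesis
      using 3 seed_disc_rotate[of R k u "Suc 0" "i + j" "z @ w" v] by (simp add: add.commute)
  next
    case 4
    then show ?thesis by simp
  qed
qed

text \<open>An untouched seed has area at most \<open>k\<close>; a grown one has a seed of area at
  most \<open>k + 1\<close> and a remainder of area at most \<open>i - 1\<close>, so
  \<open>k + i\<close> in total.\<close>

lemma seed_disc_area:
  assumes "u \<in> C_set R k" "seed_disc R k u a i z" "a \<le> 1"
  shows "area_le UNIV R (a * k + i) z"
proof -
  have C: "area_le UNIV R n y" if "y \<in> C_set R n" for n y
    using C_set_area[of R UNIV y n] that by (simp add: subset_iff)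
  show ?thesis
  proof (cases a)
    case 0
    then show ?thesis using assms(2) face_disc_area by simp
  next
    case (Suc a')
    then have a: "a = Suc 0" using assms(3) by simp
    show ?thesis
    proof (cases i)
      case 0
      then show ?thesis using a assms(2) C[OF C_set_cyclic_conjugate[OF assms(1)]] by simp
    next
      case (Suc j)
      then obtain y g h where y: "y = [] \<or> y \<in> C_set R (Suc k)"
          "rho z = rho (g @ y @ word_inv g @ h)" "area_le UNIV R j h"
        using a assms(2) by (auto simp: seeded_def)
      have "area_le UNIV R (Suc k) y" using y(1) C by auto
      then have "area_le UNIV R (Suc k + j) ((g @ y @ word_inv g) @ h)"
        by (rule area_le_append[OF area_le_conj y(3)]) simp
      then show ?thesis
        using a Suc y(2) area_le_rho_cong[of "(g @ y @ word_inv g) @ h" z] by simp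
    qed
  qed
qed

lemma cactus_area:
  assumes "u \<in> C_set R k" "cactus (seed_disc R k u) a i w" "a \<le> 1"
  shows "area_le UNIV R (a * k + i) w"
  using assms(2,3)
proof induction
  case (pair a i p q x)
  have "rho (p @ q) = rho (p @ [x, letter_inv x] @ q)" using rho_cancel[of p x q] by simp
  then show ?case using area_le_rho_cong pair by blast
next
  case (disc b j z a i p q)
  have "area_le UNIV R ((a * k + i) + (b * k + j)) (p @ z @ q)"
    using disc.prems by (intro area_le_insert[OF seed_disc_area[OF assms(1) disc(1)] disc.IH]) simp_all
  then show ?case by (simp add: algebra_simps)
qed simp

text \<open>A product of conjugates is itself a cactus word: each \<open>r\<close> is a one-face
  disc on a stalk \<open>a\<close>.\<close>

lemma area_le_cactus:
  assumes "area_le UNIV R n w"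
  obtains h m where "rho h = rho w" "m \<le> n" "cactus (seed_disc R k u) 0 m h"
proof -
  obtain ps where ps: "length ps \<le> n" "set ps \<subseteq> words UNIV \<times> R"
      "rho w = rho (concat (map (\<lambda>(a, r). a @ r @ word_inv a) ps))"
    using assms by (auto simp: area_le_def)
  have "cactus (seed_disc R k u) 0 (length ps) (concat (map (\<lambda>(a, r). a @ r @ word_inv a) ps))"
    using ps(2)
  proof (induction ps)
    case Nil
    then show ?case by (auto intro: cactus.nil)
  next
    case (Cons c ps)
    obtain a r where c: "c = (a, r)" by (cases c)
    then have "r \<in> C_set R (Suc 0)"
      using Cons.prems self_cyclic_conjugate[of r] by (auto simp: C_set.simps(2))
    then have "seed_disc R k u 0 (Suc 0) r" by (simp add: face_disc_face)
    then show ?case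
      using Cons c cactus_insert_conj[of "seed_disc R k u" 0 "Suc 0" r 0 "length ps"] by simp
  qed
  then show ?thesis using that[OF ps(3)[symmetric] ps(1)] by simp
qed

section \<open>Reduced cactus words lie in D\<close>

text \<open>With \<open>z\<close> removed, \<open>p\<close> and \<open>q\<close> may cancel along
  some \<open>b\<close>. That part stays with \<open>z\<close>: b z b^-1 is a subword of a reduced
  word, inserted into the reduced word p' q'. If the latter is empty, b z b^-1 is already
  everything.\<close>

lemma in_D_insertion:
  assumes w: "reduced (p @ z @ q)" "p @ z @ q \<in> words X"
    and z: "\<And>b. reduced (b @ z @ word_inv b) \<Longrightarrow> b \<in> words X \<Longrightarrow>
      \<exists>m\<ge>1. m \<le> i \<and> in_D X R m (b @ z @ word_inv b)"
    and rest: "\<And>v. rho v = rho (p @ q) \<Longrightarrow> v \<noteq> [] \<Longrightarrow> reduced v \<Longrightarrow> v \<in> words X \<Longrightarrow>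
      \<exists>m\<ge>1. m \<le> j \<and> in_D X R m v"
  shows "\<exists>m\<ge>1. m \<le> i + j \<and> in_D X R m (p @ z @ q)"
proof -
  have "reduced p" "reduced q" using w(1) by (auto simp: reduced_append)
  then obtain p' b q' where b: "p = p' @ b" "q = word_inv b @ q'" "reduced (p' @ q')"
    by (rule append_reduced_decomp)
  have eq: "p @ z @ q = p' @ (b @ z @ word_inv b) @ q'" using b by simp
  then have "reduced (p' @ (b @ z @ word_inv b) @ q')" using w(1) by simp
  then have "reduced (b @ z @ word_inv b)" by (metis reduced_append)
  then obtain m where m: "m \<ge> 1" "m \<le> i" "in_D X R m (b @ z @ word_inv b)"
    using z[of b] w(2) b by auto
  show ?thesis
  proof (cases "p' @ q' = []")
    case True
    then show ?thesis using m eq by (intro exI[of _ m]) auto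
  next
    case False
    moreover have "rho (p' @ q') = rho (p @ q)" using b by simp
    ultimately obtain n where n: "n \<ge> 1" "n \<le> j" "in_D X R n (p' @ q')"
      using rest[of "p' @ q'"] b w(2) by auto
    have "in_D X R (m + n) (p @ z @ q)"
      using m n w(1) eq by (intro in_D.insert[of m n X R "b @ z @ word_inv b" "p' @ q'"])
        (auto simp: insertions_def)
    then show ?thesis using m n by (intro exI[of _ "m + n"]) auto
  qed
qed

text \<open>Look at the last insertion. It is no pair, since the word is reduced. An ordinary disc
  or an untouched seed is split off; a grown seed leads to \<open>C\<^sub>k\<close> with
  \<open>k\<close> raised by one and fewer remaining faces.\<close>

lemma reduced_cactus_in_D:
  assumes k: "k \<ge> 1" "u \<in> C_set R k" "k + j \<le> n"
    and area: "\<And>i v. i < n \<Longrightarrow> v \<noteq> [] \<Longrightarrow> reduced v \<Longrightarrow> v \<in> words X \<Longrightarrow> area_le UNIV R i v \<Longrightarrow>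
      \<exists>m\<ge>1. m \<le> i \<and> in_D X R m v"
    and seed: "\<And>i v. i < j \<Longrightarrow> v \<noteq> [] \<Longrightarrow> reduced v \<Longrightarrow> v \<in> words X \<Longrightarrow>
      seeded R (C_set R (Suc k)) i v \<Longrightarrow> \<exists>m\<ge>1. m \<le> Suc k + i \<and> in_D X R m v"
    and w: "cactus (seed_disc R k u) a l w" "a = 1" "l \<le> j" "w \<noteq> []" "reduced w" "w \<in> words X"
  shows "\<exists>m\<ge>1. m \<le> k + j \<and> in_D X R m w"
  using w
proof induction
  case nil
  then show ?case by simp
next
  case (pair a i p q x)
  then show ?case by (simp add: reduced_append reduced_Cons)
next
  case (disc b i' z a i p q)
  consider "b = 0" "z = []" | "b = 0" "z \<noteq> []" | "b = 1" "i' = 0" | l where "b = 1" "i' = Suc l"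
    using disc.prems(1) by (cases i'; cases b) auto
  then show ?case
  proof cases
    case 1
    \<comment> \<open>An empty disc changes only the weights, so the induction hypothesis for
      \<open>p @ q\<close> suffices.\<close>
    then show ?thesis using disc by simp
  next
    case 2
    then have z: "face_disc R i' z" using disc.hyps(1) by simp
    obtain c z' where "z = [] @ c # z'" using 2(2) by (cases z) auto
    then have "face_disc R i' ([] @ c # z')" using z by simp
    \<comment> \<open>This makes k + i < n for the rest, while i' < n because k is positive;
      \<open>area\<close> thus covers both pieces.\<close>
    then have "i' \<ge> 1" by (rule face_discD) simp
    have pq: "area_le UNIV R (k + i) (p @ q)"
      using cactus_area[OF k(2) disc.hyps(2)] 2 disc.prems(1) by simp
    have "\<exists>m\<ge>1. m \<le> i' + (k + i) \<and> in_D X R m (p @ z @ q)"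
    proof (rule in_D_insertion)
      fix b assume b: "reduced (b @ z @ word_inv b)" "b \<in> words X"
      show "\<exists>m\<ge>1. m \<le> i' \<and> in_D X R m (b @ z @ word_inv b)"
        using b disc.prems k 2(2) area_le_conj[OF face_disc_area[OF z], of b] by (intro area) auto
    next
      fix v assume v: "rho v = rho (p @ q)" "v \<noteq> []" "reduced v" "v \<in> words X"
      then have "area_le UNIV R (k + i) v" using pq area_le_rho_cong[of "p @ q" v] by simp
      then show "\<exists>m\<ge>1. m \<le> k + i \<and> in_D X R m v"
        using v disc.prems(2) k(3) \<open>i' \<ge> 1\<close> by (intro area) auto
    qed (use disc.prems in auto)
    then show ?thesis using disc.prems(2) by fastforce
  next
    case 3
    then have z: "z \<in> C_set R k" using disc.hyps(1) k(2) C_set_cyclic_conjugate by auto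
    have pq: "area_le UNIV R i (p @ q)"
      using cactus_area[OF k(2) disc.hyps(2)] 3 disc.prems(1) by simp
    have "\<exists>m\<ge>1. m \<le> k + i \<and> in_D X R m (p @ z @ q)"
    proof (rule in_D_insertion)
      fix b assume b: "reduced (b @ z @ word_inv b)" "b \<in> words X"
      then show "\<exists>m\<ge>1. m \<le> k \<and> in_D X R m (b @ z @ word_inv b)"
        using k(1) z in_D.conj by blast
    next
      fix v assume v: "rho v = rho (p @ q)" "v \<noteq> []" "reduced v" "v \<in> words X"
      then have "area_le UNIV R i v" using pq area_le_rho_cong[of "p @ q" v] by simp
      then show "\<exists>m\<ge>1. m \<le> i \<and> in_D X R m v"
        using v disc.prems(2) k(1,3) by (intro area) auto
    qed (use disc.prems in auto)
    then show ?thesis using disc.prems(2) by fastforce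
  next
    case (4 l)
    then have "seeded R (insert [] (C_set R (Suc k))) l z" using disc.hyps(1) by simp
    moreover have "area_le UNIV R i (p @ q)"
      using cactus_area[OF k(2) disc.hyps(2)] 4 disc.prems(1) by simp
    ultimately have "seeded R (insert [] (C_set R (Suc k))) (l + i) (p @ z @ q)"
      by (rule seeded_insert)
    \<comment> \<open>In the second case the seed was cancelled completely by the attached face, and
      only the smaller area remains.\<close>
    then consider "seeded R (C_set R (Suc k)) (l + i) (p @ z @ q)" | "area_le UNIV R (l + i) (p @ z @ q)"
      using seeded_insert_Nil by blast
    then show ?thesis
    proof cases
      case 1
      then obtain m where "m \<ge> 1" "m \<le> Suc k + (l + i)" "in_D X R m (p @ z @ q)"
        using seed[of "l + i" "p @ z @ q"] disc.prems 4 by auto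
      then show ?thesis using disc.prems(2) 4 by (intro exI[of _ m]) auto
    next
      case 2
      then obtain m where "m \<ge> 1" "m \<le> l + i" "in_D X R m (p @ z @ q)"
        using area[of "l + i" "p @ z @ q"] disc.prems 4 k by auto
      then show ?thesis using disc.prems(2) 4 by (intro exI[of _ m]) auto
    qed
  qed
qed

text \<open>Inner induction on the remainder \<open>j\<close> with \<open>n\<close> fixed: each
  growth step raises \<open>k\<close> by one and lowers \<open>j\<close>, so \<open>k + j\<close>
  never increases. The premise \<open>area\<close> carries the outer induction.\<close>

lemma seeded_in_D:
  assumes R: "\<And>r. r \<in> R \<Longrightarrow> r \<noteq> [] \<and> cyclically_reduced r"
    and area: "\<And>i v. i < n \<Longrightarrow> v \<noteq> [] \<Longrightarrow> reduced v \<Longrightarrow> v \<in> words X \<Longrightarrow> area_le UNIV R i v \<Longrightarrow>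
      \<exists>m\<ge>1. m \<le> i \<and> in_D X R m v"
    and "k \<ge> 1" "k + j \<le> n" "seeded R (C_set R k) j w" "w \<noteq> []" "reduced w" "w \<in> words X"
  shows "\<exists>m\<ge>1. m \<le> k + j \<and> in_D X R m w"
  using assms(3-)
proof (induction j arbitrary: k w rule: less_induct)
  case (less j)
  obtain u g h where u: "u \<in> C_set R k" "rho w = rho (g @ u @ word_inv g @ h)" "area_le UNIV R j h"
    using less.prems(3) by (auto simp: seeded_def)
  have "cyclically_reduced u" using C_set_nonempty[OF R] u(1) by blast
  then interpret closed_discs "seed_disc R k u"
    using closed_discs_seed_disc less.prems(1) u(1) by blast
  obtain h' l where h': "rho h' = rho h" "l \<le> j" "cactus (seed_disc R k u) 0 l h'"
    using area_le_cactus[OF u(3)] by metis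
  have "seed_disc R k u (Suc 0) 0 u" by (simp add: self_cyclic_conjugate)
  then have "cactus (seed_disc R k u) 1 l (g @ u @ word_inv g @ h')"
    using cactus_insert_conj[of "seed_disc R k u" "Suc 0" 0 u 0 l h' g] h'(3) by simp
  \<comment> \<open>Closure under cancellation turns the unreduced product into \<open>w\<close>
    with unchanged weights.\<close>
  from cactus_rho[OF this]
  have "cactus (seed_disc R k u) 1 l w"
    using u(2) rho_cong[OF refl h'(1), of "g @ u @ word_inv g"] less.prems(5)
    by (simp add: rho_reduced)
  show ?case
  proof (rule reduced_cactus_in_D[OF less.prems(1) u(1) less.prems(2) area _ \<open>cactus _ 1 l w\<close>])
    fix i v assume "i < j" "v \<noteq> []" "reduced v" "v \<in> words X" "seeded R (C_set R (Suc k)) i v"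
    then show "\<exists>m\<ge>1. m \<le> Suc k + i \<and> in_D X R m v"
      using less.prems(2) by (intro less.IH) auto
  qed (use less.prems h' in auto)
qed

text \<open>Outer induction on the area; the relator of the first conjugate serves as the initial
  seed with \<open>k = 1\<close>.\<close>

lemma area_le_in_D:
  assumes R: "\<And>r. r \<in> R \<Longrightarrow> r \<noteq> [] \<and> cyclically_reduced r"
    and "area_le UNIV R n w" "w \<noteq> []" "reduced w" "w \<in> words X"
  shows "\<exists>m\<ge>1. m \<le> n \<and> in_D X R m w"
  using assms(2-)
proof (induction n arbitrary: w rule: less_induct)
  case (less n)
  obtain ps where ps: "length ps \<le> n" "set ps \<subseteq> words UNIV \<times> R"
      "rho w = rho (concat (map (\<lambda>(a, r). a @ r @ word_inv a) ps))"
    using less.prems(1) by (auto simp: area_le_def)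
  have "ps \<noteq> []" using ps(3) less.prems(2,3) by (auto simp: rho_reduced)
  then obtain a r qs where qs: "ps = (a, r) # qs" by (cases ps) auto
  then have "r \<in> C_set R (Suc 0)"
    using ps(2) self_cyclic_conjugate[of r] by (auto simp: C_set.simps(2))
  moreover have "area_le UNIV R (length qs) (concat (map (\<lambda>(a, r). a @ r @ word_inv a) qs))"
    unfolding area_le_def using ps(2) qs by auto
  moreover have "rho w = rho (a @ r @ word_inv a @ concat (map (\<lambda>(a, r). a @ r @ word_inv a) qs))"
    using ps(3) qs by simp
  ultimately have "seeded R (C_set R (Suc 0)) (length qs) w"
    unfolding seeded_def by blast
  then have "\<exists>m\<ge>1. m \<le> Suc 0 + length qs \<and> in_D X R m w"
    by (rule seeded_in_D[OF R less.IH, rotated -4]) (use less.prems ps(1) qs in auto)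
  then show ?case using ps(1) qs by fastforce
qed

text \<open>The empty relator has area 0 but lies in no \<open>D\<^sub>k\<close>, hence the
  condition \<open>w \<noteq> []\<close>. The index \<open>m\<close> found for \<open>w\<close> is
  at most the area by \<open>area_le_in_D\<close> and at least the area by
  \<open>in_D_area\<close>.\<close>

theorem mainTheorem1:
  fixes X :: "'x set" and R :: "'x word set" and w :: "'x word"
  assumes "R \<subseteq> words X"
    and "\<And>r. r \<in> R \<Longrightarrow> r \<noteq> [] \<and> cyclically_reduced r"
    and "word_inv ` R \<subseteq> R"
    and "w \<in> relators X R"
    and "w \<noteq> []"
  shows "w \<in> D_union X R \<and> Area X R w = (LEAST k. k \<ge> 1 \<and> w \<in> D_set X R k)"
proof -
  let ?rep = "\<lambda>k. \<exists>ps. length ps = k \<and> set ps \<subseteq> carrier (free_group X) \<times> R \<and>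
     w = rho (concat (map (\<lambda>(a, r). a @ r @ word_inv a) ps))"
  have w: "\<exists>n. area_le X R n w" "w \<in> words X" "reduced w"
    using relator_area_le[OF assms(1) _ assms(3,4)] assms(2) by (auto simp: cyclically_reduced_def)
  have rep: "\<exists>k\<le>n. ?rep k" if "area_le X R n w" for n
    by (rule area_le_reduced_conjugators[OF that w(3)]) blast
  then have "\<exists>k. ?rep k" using w(1) by blast
  then have "?rep (Area X R w)" unfolding Area_def by (rule LeastI_ex)
  then have "area_le X R (Area X R w) w"
    unfolding area_le_def using w(3) by (force simp: free_group_def rho_reduced)
  from area_le_in_D[OF assms(2) area_le_UNIV[OF this] assms(5) w(3,2)]
  obtain m where m: "m \<ge> 1" "m \<le> Area X R w" "w \<in> D_set X R m"
    by (auto simp: D_set_def)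
  have min: "Area X R w \<le> k" if "w \<in> D_set X R k" for k
  proof -
    have "area_le X R k w" using that in_D_area[OF assms(1)] by (auto simp: D_set_def)
    then obtain l where "l \<le> k" "?rep l" using rep by blast
    have "Area X R w \<le> l" unfolding Area_def by (rule Least_le) (fact \<open>?rep l\<close>)
    then show ?thesis using \<open>l \<le> k\<close> by simp
  qed
  have "m = Area X R w" using m(2) min[OF m(3)] by simp
  then have "(LEAST k. k \<ge> 1 \<and> w \<in> D_set X R k) = Area X R w"
    using m min by (intro Least_equality) auto
  then show ?thesis using m(1,3) by (auto simp: D_union_def)
qed

end
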